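(* Let $0<\alpha_1,\alpha_2<1$, let $K_1,K_2$ be constants, let $L,T>0$, let $M,N$ be positive integers, and set $h=L/M$, $\tau=T/N$. Then the finite difference scheme (S1) described in the context is uniquely solvable: for any given data $f,\varphi_1,\varphi_2$ there is exactly one grid function $\{u_j^k\mid 0\le j\le M,\ 0\le k\le N\}$ satisfying it.
   Context: Grid: $x_j=jh$ $(0\le j\le M)$, $t_k=k\tau$ $(0\le k\le N)$, $t_{k+\frac12}=(k+\tfrac12)\tau$. Operators: $\delta_x^2u_j=(u_{j+1}-2u_j+u_{j-1})/h^2$; $\mathscr{L}u_j=\left(I+\frac{h^2}{12}\delta_x^2\right)u_j$ for $1\le j\le M-1$ and $\mathscr{L}u_j=u_j$ for $j=0,M$, where $I$ is the identity; when $\mathscr L$ is applied to $f$ it acts on the grid values $f(x_j,t)$. Coefficients: for $\beta\in(0,1)$, $\varpi_\ell^{(\beta)}$ are defined by $\left(\frac{3\beta+1}{2\beta}-\frac{2\beta+1}{\beta}z+\frac{\beta+1}{2\beta}z^2\right)^{\beta}=\sum_{\ell=0}^\infty\varpi_\ell^{(\beta)}z^\ell$, $|z|<1$ (branch positive at $z=0$). The scheme (S1) approximates the fractional Cable equation $\partial_tu=K_1\,{}_{\mathrm{RL}}\mathrm{D}_{0,t}^{1-\alpha_1}\partial_x^2u-K_2\,{}_{\mathrm{RL}}\mathrm{D}_{0,t}^{1-\alpha_2}u+f(x,t)$ on $0<x<L$, $0<t\le T$, with $u(x,0)=0$, $u(0,t)=\varphi_1(t)$, $u(L,t)=\varphi_2(t)$,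 and reads: for $1\le j\le M-1$, $0\le k\le N-1$, $$\mathscr{L}\frac{u_j^{k+1}-u_j^k}{\tau}=K_1\tau^{\alpha_1-1}\sum_{\ell=0}^{k}\varpi_\ell^{(1-\alpha_1)}\delta_x^2u_j^{k-\ell}-K_2\tau^{\alpha_2-1}\sum_{\ell=0}^{k}\varpi_\ell^{(1-\alpha_2)}\mathscr{L}u_j^{k-\ell}+\mathscr{L}f(x_j,t_{k+\frac12}),$$ with $u_j^0=0$ $(0\le j\le M)$, $u_0^k=\varphi_1(t_k)$, $u_M^k=\varphi_2(t_k)$ $(1\le k\le N)$. *)

theory Defs
  imports "HOL-Complex_Analysis.Complex_Analysis"
begin

definition gen_poly :: "real \<Rightarrow> complex \<Rightarrow> complex" where
  "gen_poly \<beta> z = of_real ((3 * \<beta> + 1) / (2 * \<beta>)) - of_real ((2 * \<beta> + 1) / \<beta>) * z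
      + of_real ((\<beta> + 1) / (2 * \<beta>)) * z\<^sup>2"

text \<open>
  For \<open>0 < \<beta> < 1\<close> the polynomial maps the open unit disc into the plane slit along the
  nonpositive real axis (\<open>gen_poly_slit\<close> below), so the principal power is the
  holomorphic branch on the disc that is positive at \<open>z = 0\<close>.  Existence and uniqueness of the
  real coefficients are \<open>varpi_ex1\<close>.
\<close>

definition varpi :: "real \<Rightarrow> nat \<Rightarrow> real" where
  "varpi \<beta> = (THE w. \<forall>z. norm z < 1 \<longrightarrow>
      (\<lambda>l. of_real (w l) * z ^ l) sums (gen_poly \<beta> z powr of_real \<beta>))"

text \<open>Only used for \<open>j \<ge> 1\<close>, so that \<open>j - 1\<close> is not truncated.\<close>

definition delta_x2 :: "real \<Rightarrow> (nat \<Rightarrow> real) \<Rightarrow> nat \<Rightarrow> real" where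
  "delta_x2 h v j = (v (j + 1) - 2 * v j + v (j - 1)) / h\<^sup>2"

definition compact_op :: "nat \<Rightarrow> real \<Rightarrow> (nat \<Rightarrow> real) \<Rightarrow> nat \<Rightarrow> real" where
  "compact_op M h v j = (if 1 \<le> j \<and> j < M then v j + h\<^sup>2 / 12 * delta_x2 h v j else v j)"

text \<open>The value \<open>u (j, k)\<close> is the grid value at the point \<open>(j * h, k * \<tau>)\<close>.\<close>

definition scheme_S1 ::
  "real \<Rightarrow> real \<Rightarrow> real \<Rightarrow> real \<Rightarrow> nat \<Rightarrow> nat \<Rightarrow> real \<Rightarrow> real \<Rightarrow>
   (real \<Rightarrow> real \<Rightarrow> real) \<Rightarrow> (real \<Rightarrow> real) \<Rightarrow> (real \<Rightarrow> real) \<Rightarrow> (nat \<times> nat \<Rightarrow> real) \<Rightarrow> bool" where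
  "scheme_S1 \<alpha>\<^sub>1 \<alpha>\<^sub>2 K\<^sub>1 K\<^sub>2 M N h \<tau> f \<phi>\<^sub>1 \<phi>\<^sub>2 u \<longleftrightarrow>
     (\<forall>j k. 1 \<le> j \<and> j < M \<and> k < N \<longrightarrow>
        compact_op M h (\<lambda>i. (u (i, k + 1) - u (i, k)) / \<tau>) j =
          K\<^sub>1 * \<tau> powr (\<alpha>\<^sub>1 - 1) *
            (\<Sum>l\<le>k. varpi (1 - \<alpha>\<^sub>1) l * delta_x2 h (\<lambda>i. u (i, k - l)) j)
          - K\<^sub>2 * \<tau> powr (\<alpha>\<^sub>2 - 1) *
            (\<Sum>l\<le>k. varpi (1 - \<alpha>\<^sub>2) l * compact_op M h (\<lambda>i. u (i, k - l)) j)
          + compact_op M h (\<lambda>i. f (real i * h) ((real k + 1 / 2) * \<tau>)) j) \<and>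
     (\<forall>j\<le>M. u (j, 0) = 0) \<and>
     (\<forall>k. 1 \<le> k \<and> k \<le> N \<longrightarrow>
        u (0, k) = \<phi>\<^sub>1 (real k * \<tau>) \<and> u (M, k) = \<phi>\<^sub>2 (real k * \<tau>))"

lemma gen_poly_factor:
  assumes "\<beta> > 0"
  shows "gen_poly \<beta> z =
    (1 - z) * (of_real ((3 * \<beta> + 1) / (2 * \<beta>)) - of_real ((\<beta> + 1) / (2 * \<beta>)) * z)"
proof -
  have "(2 * \<beta> + 1) / \<beta> = (3 * \<beta> + 1) / (2 * \<beta>) + (\<beta> + 1) / (2 * \<beta>)"
    using assms by (simp add: field_simps)
  hence "complex_of_real ((2 * \<beta> + 1) / \<beta>) =
      of_real ((3 * \<beta> + 1) / (2 * \<beta>)) + of_real ((\<beta> + 1) / (2 * \<beta>))"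
    by (metis of_real_add)
  thus ?thesis
    unfolding gen_poly_def
    by (simp only: distrib_right distrib_left left_diff_distrib right_diff_distrib
        power2_eq_square mult_1_left mult_1_right mult.assoc mult.commute mult.left_commute)
       (simp del: of_real_divide)
qed

lemma mult_halfplane_slit:
  fixes a b :: complex
  assumes "Re a > 0" "Re b > 0"
  shows "a * b \<notin> \<real>\<^sub>\<le>\<^sub>0"
proof
  assume "a * b \<in> \<real>\<^sub>\<le>\<^sub>0"
  hence 1: "Re a * Re b \<le> Im a * Im b" and 2: "Re a * Im b = - (Im a * Re b)"
    by (auto simp: complex_nonpos_Reals_iff)
  have "Re a * (Re a * Re b) \<le> Re a * (Im a * Im b)"
    using 1 assms by (intro mult_left_mono) auto
  also have "\<dots> = - (Im a * Im a * Re b)"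
    using 2 by (metis mult.assoc mult.left_commute mult_minus_right)
  also have "\<dots> \<le> 0" using assms by simp
  finally show False using assms
    by (smt (verit) mult_pos_pos)
qed

lemma gen_poly_slit:
  assumes "\<beta> > 0" "norm z < 1"
  shows "gen_poly \<beta> z \<notin> \<real>\<^sub>\<le>\<^sub>0"
proof -
  have z: "Re z < 1" using assms(2) complex_Re_le_cmod[of z] by simp
  have "(\<beta> + 1) / (2 * \<beta>) * Re z < (\<beta> + 1) / (2 * \<beta>) * 1"
    using z assms by (intro mult_strict_left_mono) auto
  also have "\<dots> < (3 * \<beta> + 1) / (2 * \<beta>)"
    using assms by (simp add: field_simps)
  finally have "Re (of_real ((3 * \<beta> + 1) / (2 * \<beta>)) - of_real ((\<beta> + 1) / (2 * \<beta>)) * z) > 0"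
    by (simp del: of_real_divide)
  thus ?thesis unfolding gen_poly_factor[OF assms(1)]
    using z by (intro mult_halfplane_slit) auto
qed

lemma gen_poly_cnj: "gen_poly \<beta> (cnj z) = cnj (gen_poly \<beta> z)"
  by (simp add: gen_poly_def)

lemma varpi_ex1:
  assumes "0 < \<beta>"
  shows "\<exists>!w :: nat \<Rightarrow> real. \<forall>z. norm z < 1 \<longrightarrow>
      (\<lambda>l. of_real (w l) * z ^ l) sums (gen_poly \<beta> z powr of_real \<beta>)"
proof -
  define F where "F = (\<lambda>z. gen_poly \<beta> z powr of_real \<beta>)"
  have hol: "F holomorphic_on ball 0 1"
    unfolding F_def
    by (intro holomorphic_intros)
       (use gen_poly_slit[OF assms] in \<open>auto simp: gen_poly_def intro!: holomorphic_intros\<close>)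
  define c where "c = (\<lambda>n. (deriv ^^ n) F 0 / fact n)"
  have c: "(\<lambda>n. c n * z ^ n) sums F z" if "norm z < 1" for z
    using holomorphic_power_series[OF hol, of z] that by (simp add: c_def)
  have expansion: "F has_fps_expansion Abs_fps a"
    if "\<And>z. norm z < 1 \<Longrightarrow> (\<lambda>n. a n * z ^ n) sums F z" for a
  proof (rule has_fps_expansionI)
    have "eventually (\<lambda>z::complex. z \<in> ball 0 1) (nhds 0)"
      by (intro eventually_nhds_in_open) auto
    thus "eventually (\<lambda>z. (\<lambda>n. fps_nth (Abs_fps a) n * z ^ n) sums F z) (nhds 0)"
      by eventually_elim (use that in auto)
  qed
  have uniq: "a = c" if "\<And>z. norm z < 1 \<Longrightarrow> (\<lambda>n. a n * z ^ n) sums F z" for a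
    using fps_expansion_unique_complex[OF expansion[of a, OF that] expansion[of c, OF c]]
    by (simp add: fps_eq_iff fun_eq_iff)
  have "(\<lambda>n. cnj (c n)) = c"
  proof (rule uniq)
    fix z :: complex assume z: "norm z < 1"
    have "(\<lambda>n. cnj (c n * cnj z ^ n)) sums cnj (F (cnj z))"
      using c[of "cnj z"] z by (simp only: sums_cnj complex_mod_cnj)
    moreover have "F (cnj z) = cnj (F z)"
    proof -
      have "Im (gen_poly \<beta> z) = 0 \<Longrightarrow> Re (gen_poly \<beta> z) \<ge> 0"
        using gen_poly_slit[OF assms z] by (auto simp: complex_nonpos_Reals_iff)
      from cnj_powr[OF this, of "of_real \<beta>"] show ?thesis
        by (simp add: F_def gen_poly_cnj)
    qed
    ultimately show "(\<lambda>n. cnj (c n) * z ^ n) sums F z" by simp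
  qed
  hence real: "c n \<in> \<real>" for n
    by (simp add: Reals_cnj_iff fun_eq_iff)
  show ?thesis
  proof (rule ex1I[of _ "\<lambda>n. Re (c n)"])
    show "\<forall>z. norm z < 1 \<longrightarrow>
        (\<lambda>l. of_real (Re (c l)) * z ^ l) sums (gen_poly \<beta> z powr of_real \<beta>)"
      using c real by (simp add: F_def)
  next
    fix w :: "nat \<Rightarrow> real"
    assume "\<forall>z. norm z < 1 \<longrightarrow>
        (\<lambda>l. of_real (w l) * z ^ l) sums (gen_poly \<beta> z powr of_real \<beta>)"
    hence "(\<lambda>n. of_real (w n)) = c"
      by (intro uniq) (simp add: F_def)
    thus "w = (\<lambda>n. Re (c n))" by auto
  qed
qed

end

theory Submission
  imports Defs
begin

text \<open>
  The history sums involve only the levels up to \<open>k\<close>, so the unknown level \<open>k + 1\<close> enters only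
  through \<open>compact_op\<close>. Up to the factor \<open>1 / 12\<close> this is the tridiagonal matrix with rows
  \<open>(1, 10, 1)\<close>, and the Dirichlet problem for such a matrix is uniquely solvable by shooting: the
  solution of the homogeneous recurrence starting from \<open>0, 1\<close> grows strictly in absolute value
  and therefore does not vanish at \<open>M\<close>.
\<close>

section \<open>Shooting for a tridiagonal Dirichlet problem\<close>

fun shoot :: "real \<Rightarrow> (nat \<Rightarrow> real) \<Rightarrow> real \<Rightarrow> real \<Rightarrow> nat \<Rightarrow> real" where
  "shoot c r a s 0 = a"
| "shoot c r a s (Suc 0) = s"
| "shoot c r a s (Suc (Suc j)) = r (Suc j) - c * shoot c r a s (Suc j) - shoot c r a s j"

text \<open>By linearity of the recurrence, a change of the second starting value adds a multiple of
  the homogeneous solution. Hitting a prescribed value at one index thus becomes a scalar linear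
  equation for \<open>s\<close>.\<close>

lemma shoot_affine: "shoot c r a s j = shoot c r a 0 j + s * shoot c (\<lambda>_. 0) 0 1 j"
  by (induction c r a s j rule: shoot.induct) (simp_all add: algebra_simps)

text \<open>For consecutive values p, q with abs p < abs q, the next one has absolute value at least
  2 * abs q - abs p > abs q. Without the bound on \<open>c\<close> this fails: \<open>c = 0\<close>
  gives 0, 1, 0, -1.\<close>

lemma shoot_homogeneous_abs_less:
  assumes "\<bar>c\<bar> \<ge> 2"
  shows "\<bar>shoot c (\<lambda>_. 0) 0 1 j\<bar> < \<bar>shoot c (\<lambda>_. 0) 0 1 (Suc j)\<bar>"
proof (induction j)
  case (Suc j)
  define p q where "p = shoot c (\<lambda>_. 0) 0 1 j" and "q = shoot c (\<lambda>_. 0) 0 1 (Suc j)"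
  have "2 * \<bar>q\<bar> \<le> \<bar>c * q\<bar>"
    using assms by (simp add: abs_mult mult_right_mono)
  moreover have "\<bar>p\<bar> < \<bar>q\<bar>"
    using Suc by (simp add: p_def q_def)
  ultimately have "\<bar>q\<bar> < \<bar>- c * q - p\<bar>"
    by linarith
  thus ?case by (simp add: p_def q_def)
qed simp

lemma shoot_homogeneous_nonzero:
  assumes "\<bar>c\<bar> \<ge> 2" "0 < j"
  shows "shoot c (\<lambda>_. 0) 0 1 j \<noteq> 0"
  using shoot_homogeneous_abs_less[OF assms(1), of "j - 1"] assms(2) by auto

text \<open>Each row can be solved for its last entry, so the first two values propagate up to index
  \<open>M\<close>. The induction is strong because every value depends on its two
  predecessors.\<close>

lemma tridiagonal_eq_shoot:
  fixes c :: real and r :: "nat \<Rightarrow> real"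
  assumes "\<And>j. 1 \<le> j \<Longrightarrow> j < M \<Longrightarrow> v (j - 1) + c * v j + v (j + 1) = r j" "j \<le> M"
  shows "v j = shoot c r (v 0) (v 1) j"
  using assms(2)
proof (induction j rule: less_induct)
  case (less j)
  consider "j = 0" | "j = 1" | i where "j = Suc (Suc i)"
    by (metis One_nat_def not0_implies_Suc)
  thus ?case
  proof cases
    case (3 i)
    \<comment> \<open>Row \<open>Suc i\<close> is available: \<open>Suc (Suc i)\<close> is at most
      \<open>M\<close>, so \<open>Suc i\<close> is interior.\<close>
    thus ?thesis using less.IH[of i] less.IH[of "Suc i"] assms(1)[of "Suc i"] less.prems
      by simp
  qed simp_all
qed

lemma tridiagonal_solvable:
  fixes c :: real and r :: "nat \<Rightarrow> real"
  assumes "\<bar>c\<bar> \<ge> 2" "0 < M"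
  obtains v where "v 0 = a" "v M = b"
    "\<And>j. 1 \<le> j \<Longrightarrow> j < M \<Longrightarrow> v (j - 1) + c * v j + v (j + 1) = r j"
proof
  \<comment> \<open>The root of the affine equation from \<open>shoot_affine\<close> for the value
    \<open>b\<close> at \<open>M\<close>; growth makes the denominator nonzero.\<close>
  define s where "s = (b - shoot c r a 0 M) / shoot c (\<lambda>_. 0) 0 1 M"
  show "shoot c r a s 0 = a" by simp
  show "shoot c r a s M = b"
    using shoot_homogeneous_nonzero[OF assms] by (subst shoot_affine) (simp add: s_def)
  show "shoot c r a s (j - 1) + c * shoot c r a s j + shoot c r a s (j + 1) = r j"
    if "1 \<le> j" for j
    using that by (cases j) simp_all
qed

lemma tridiagonal_unique:
  fixes c :: real and r :: "nat \<Rightarrow> real"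
  assumes "\<bar>c\<bar> \<ge> 2" "0 < M" "v 0 = w 0" "v M = w M"
    and "\<And>j. 1 \<le> j \<Longrightarrow> j < M \<Longrightarrow> v (j - 1) + c * v j + v (j + 1) = r j"
    and "\<And>j. 1 \<le> j \<Longrightarrow> j < M \<Longrightarrow> w (j - 1) + c * w j + w (j + 1) = r j"
    and "j \<le> M"
  shows "v j = w j"
proof -
  have v: "v i = shoot c r (v 0) (v 1) i" and w: "w i = shoot c r (w 0) (w 1) i"
    if "i \<le> M" for i
    using tridiagonal_eq_shoot[of M v c r i] tridiagonal_eq_shoot[of M w c r i] assms(5,6) that
    by blast+
  \<comment> \<open>Both sequences are shooting solutions with the same \<open>r\<close> and first
    value, so their equality at \<open>M\<close> leaves only the homogeneous multiples.\<close>
  have "v 1 * shoot c (\<lambda>_. 0) 0 1 M = w 1 * shoot c (\<lambda>_. 0) 0 1 M"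
    using v[of M] w[of M] assms(3,4)
      shoot_affine[of c r "v 0" "v 1" M] shoot_affine[of c r "w 0" "w 1" M] by simp
  hence "v 1 = w 1" using shoot_homogeneous_nonzero[OF assms(1,2)] by simp
  thus ?thesis using v w assms(3,7) by metis
qed

section \<open>The spatial operators on the grid\<close>

lemma compact_op_interior:
  assumes "h \<noteq> 0" "1 \<le> j" "j < M"
  shows "compact_op M h v j = (v (j - 1) + 10 * v j + v (j + 1)) / 12"
  \<comment> \<open>The powers of \<open>h\<close> cancel, and the middle weight is 1 - 2/12 =
    10/12.\<close>
  using assms by (simp add: compact_op_def delta_x2_def field_simps)

lemma delta_x2_cong:
  assumes "\<And>i. i \<le> M \<Longrightarrow> v i = w i" "j < M"
  shows "delta_x2 h v j = delta_x2 h w j"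
  using assms by (simp add: delta_x2_def)

lemma compact_op_cong:
  assumes "\<And>i. i \<le> M \<Longrightarrow> v i = w i" "j < M"
  shows "compact_op M h v j = compact_op M h w j"
  using assms by (simp add: compact_op_def delta_x2_def)

section \<open>One time step as a linear system\<close>

definition scheme_rhs ::
  "real \<Rightarrow> real \<Rightarrow> real \<Rightarrow> real \<Rightarrow> nat \<Rightarrow> real \<Rightarrow> real \<Rightarrow>
   (real \<Rightarrow> real \<Rightarrow> real) \<Rightarrow> (nat \<times> nat \<Rightarrow> real) \<Rightarrow> nat \<Rightarrow> nat \<Rightarrow> real" where
  "scheme_rhs \<alpha>\<^sub>1 \<alpha>\<^sub>2 K\<^sub>1 K\<^sub>2 M h \<tau> f u k j =
     K\<^sub>1 * \<tau> powr (\<alpha>\<^sub>1 - 1) *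
       (\<Sum>l\<le>k. varpi (1 - \<alpha>\<^sub>1) l * delta_x2 h (\<lambda>i. u (i, k - l)) j)
     - K\<^sub>2 * \<tau> powr (\<alpha>\<^sub>2 - 1) *
       (\<Sum>l\<le>k. varpi (1 - \<alpha>\<^sub>2) l * compact_op M h (\<lambda>i. u (i, k - l)) j)
     + compact_op M h (\<lambda>i. f (real i * h) ((real k + 1 / 2) * \<tau>)) j"

text \<open>What remains on the right after multiplying the scheme by 12 * \<tau> and moving level
  \<open>k\<close> over from the difference quotient.\<close>

definition step_rhs ::
  "real \<Rightarrow> real \<Rightarrow> real \<Rightarrow> real \<Rightarrow> nat \<Rightarrow> real \<Rightarrow> real \<Rightarrow>
   (real \<Rightarrow> real \<Rightarrow> real) \<Rightarrow> (nat \<times> nat \<Rightarrow> real) \<Rightarrow> nat \<Rightarrow> nat \<Rightarrow> real" where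
  "step_rhs \<alpha>\<^sub>1 \<alpha>\<^sub>2 K\<^sub>1 K\<^sub>2 M h \<tau> f u k j =
     12 * (\<tau> * scheme_rhs \<alpha>\<^sub>1 \<alpha>\<^sub>2 K\<^sub>1 K\<^sub>2 M h \<tau> f u k j + compact_op M h (\<lambda>i. u (i, k)) j)"

text \<open>Causality: the history sums read only the levels \<open>k - l\<close>, so the system for
  level \<open>k + 1\<close> has data fixed by earlier levels.\<close>

lemma step_rhs_cong:
  assumes "\<And>i m. i \<le> M \<Longrightarrow> m \<le> k \<Longrightarrow> u (i, m) = w (i, m)" "j < M"
  shows "step_rhs \<alpha>\<^sub>1 \<alpha>\<^sub>2 K\<^sub>1 K\<^sub>2 M h \<tau> f u k j = step_rhs \<alpha>\<^sub>1 \<alpha>\<^sub>2 K\<^sub>1 K\<^sub>2 M h \<tau> f w k j"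
proof -
  have "delta_x2 h (\<lambda>i. u (i, m)) j = delta_x2 h (\<lambda>i. w (i, m)) j"
    and "compact_op M h (\<lambda>i. u (i, m)) j = compact_op M h (\<lambda>i. w (i, m)) j" if "m \<le> k" for m
    using assms that by (auto intro!: delta_x2_cong[of M] compact_op_cong)
  thus ?thesis by (simp add: step_rhs_def scheme_rhs_def)
qed

lemma scheme_S1_iff:
  assumes "h \<noteq> 0" "\<tau> \<noteq> 0"
  shows "scheme_S1 \<alpha>\<^sub>1 \<alpha>\<^sub>2 K\<^sub>1 K\<^sub>2 M N h \<tau> f \<phi>\<^sub>1 \<phi>\<^sub>2 u \<longleftrightarrow>
    (\<forall>j\<le>M. u (j, 0) = 0) \<and>
    (\<forall>k<N. u (0, Suc k) = \<phi>\<^sub>1 (real (Suc k) * \<tau>) \<and> u (M, Suc k) = \<phi>\<^sub>2 (real (Suc k) * \<tau>) \<and>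
      (\<forall>j. 1 \<le> j \<and> j < M \<longrightarrow> u (j - 1, Suc k) + 10 * u (j, Suc k) + u (j + 1, Suc k) =
        step_rhs \<alpha>\<^sub>1 \<alpha>\<^sub>2 K\<^sub>1 K\<^sub>2 M h \<tau> f u k j))"
proof -
  have step: "compact_op M h (\<lambda>i. (u (i, k + 1) - u (i, k)) / \<tau>) j =
      scheme_rhs \<alpha>\<^sub>1 \<alpha>\<^sub>2 K\<^sub>1 K\<^sub>2 M h \<tau> f u k j \<longleftrightarrow>
    u (j - 1, Suc k) + 10 * u (j, Suc k) + u (j + 1, Suc k) =
      step_rhs \<alpha>\<^sub>1 \<alpha>\<^sub>2 K\<^sub>1 K\<^sub>2 M h \<tau> f u k j" if "1 \<le> j" "j < M" for j k
  proof -
    let ?A = "u (j - 1, Suc k) + 10 * u (j, Suc k) + u (j + 1, Suc k)"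
    have "compact_op M h (\<lambda>i. (u (i, k + 1) - u (i, k)) / \<tau>) j =
        (?A / 12 - compact_op M h (\<lambda>i. u (i, k)) j) / \<tau>"
      unfolding compact_op_interior[OF assms(1) that]
      by (simp add: add_divide_distrib diff_divide_distrib)
    moreover have "(A / 12 - B) / \<tau> = C \<longleftrightarrow> A = 12 * (\<tau> * C + B)" for A B C
      using assms(2) by (auto simp: field_simps)
    ultimately show ?thesis
      unfolding step_rhs_def by simp
  qed
  \<comment> \<open>Boundary values are indexed by their own level, the difference equations by the
    preceding one; the shift aligns both on level \<open>Suc k\<close>.\<close>
  have shift: "(\<forall>k. 1 \<le> k \<and> k \<le> N \<longrightarrow> P k) \<longleftrightarrow> (\<forall>k<N. P (Suc k))" for P :: "nat \<Rightarrow> bool"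
  proof safe
    fix k assume "\<forall>k<N. P (Suc k)" "1 \<le> k" "k \<le> N"
    thus "P k" by (cases k) auto
  qed simp
  show ?thesis
    unfolding scheme_S1_def
      scheme_rhs_def[of \<alpha>\<^sub>1 \<alpha>\<^sub>2 K\<^sub>1 K\<^sub>2 M h \<tau> f u, symmetric] shift
    using step by blast
qed

text \<open>Makes induction on the number of time levels possible: \<open>h\<close> and \<tau> stay
  fixed nonzero parameters, not tied to \<open>N\<close>.\<close>

lemma scheme_S1_Suc:
  assumes "h \<noteq> 0" "\<tau> \<noteq> 0"
  shows "scheme_S1 \<alpha>\<^sub>1 \<alpha>\<^sub>2 K\<^sub>1 K\<^sub>2 M (Suc N) h \<tau> f \<phi>\<^sub>1 \<phi>\<^sub>2 u \<longleftrightarrow>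
    scheme_S1 \<alpha>\<^sub>1 \<alpha>\<^sub>2 K\<^sub>1 K\<^sub>2 M N h \<tau> f \<phi>\<^sub>1 \<phi>\<^sub>2 u \<and>
    u (0, Suc N) = \<phi>\<^sub>1 (real (Suc N) * \<tau>) \<and> u (M, Suc N) = \<phi>\<^sub>2 (real (Suc N) * \<tau>) \<and>
    (\<forall>j. 1 \<le> j \<and> j < M \<longrightarrow> u (j - 1, Suc N) + 10 * u (j, Suc N) + u (j + 1, Suc N) =
      step_rhs \<alpha>\<^sub>1 \<alpha>\<^sub>2 K\<^sub>1 K\<^sub>2 M h \<tau> f u N j)"
  unfolding scheme_S1_iff[OF assms] less_Suc_eq by blast

text \<open>Interior rows reach at most index \<open>M\<close>, and all levels read are at most
  \<open>N\<close>. Hence values off the grid, in particular on a level still to be computed, may be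
  overwritten.\<close>

lemma scheme_S1_cong:
  assumes "h \<noteq> 0" "\<tau> \<noteq> 0" "\<And>i m. i \<le> M \<Longrightarrow> m \<le> N \<Longrightarrow> u (i, m) = w (i, m)"
  shows "scheme_S1 \<alpha>\<^sub>1 \<alpha>\<^sub>2 K\<^sub>1 K\<^sub>2 M N h \<tau> f \<phi>\<^sub>1 \<phi>\<^sub>2 u \<longleftrightarrow>
    scheme_S1 \<alpha>\<^sub>1 \<alpha>\<^sub>2 K\<^sub>1 K\<^sub>2 M N h \<tau> f \<phi>\<^sub>1 \<phi>\<^sub>2 w"
  using assms(3)
proof (induction N)
  case 0
  thus ?case by (simp add: scheme_S1_iff[OF assms(1,2)])
next
  case (Suc N)
  have "step_rhs \<alpha>\<^sub>1 \<alpha>\<^sub>2 K\<^sub>1 K\<^sub>2 M h \<tau> f u N j = step_rhs \<alpha>\<^sub>1 \<alpha>\<^sub>2 K\<^sub>1 K\<^sub>2 M h \<tau> f w N j"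
    if "j < M" for j
    using Suc.prems that by (intro step_rhs_cong) auto
  moreover have "u (i, Suc N) = w (i, Suc N)" if "i \<le> M" for i
    using Suc.prems that by simp
  ultimately show ?case
    using Suc unfolding scheme_S1_Suc[OF assms(1,2)] by (auto simp del: of_nat_Suc)
qed

section \<open>Existence and uniqueness by marching in time\<close>

lemma scheme_S1_exists:
  assumes "h \<noteq> 0" "\<tau> \<noteq> 0" "0 < M"
  shows "\<exists>u. scheme_S1 \<alpha>\<^sub>1 \<alpha>\<^sub>2 K\<^sub>1 K\<^sub>2 M N h \<tau> f \<phi>\<^sub>1 \<phi>\<^sub>2 u"
proof (induction N)
  case 0
  show ?case by (rule exI[of _ "\<lambda>_. 0"]) (simp add: scheme_S1_iff[OF assms(1,2)])
next
  case (Suc N)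
  then obtain u where u: "scheme_S1 \<alpha>\<^sub>1 \<alpha>\<^sub>2 K\<^sub>1 K\<^sub>2 M N h \<tau> f \<phi>\<^sub>1 \<phi>\<^sub>2 u" ..
  have two: "2 \<le> \<bar>10 :: real\<bar>" by simp
  obtain v where v: "v 0 = \<phi>\<^sub>1 (real (Suc N) * \<tau>)" "v M = \<phi>\<^sub>2 (real (Suc N) * \<tau>)"
    "\<And>j. 1 \<le> j \<Longrightarrow> j < M \<Longrightarrow> v (j - 1) + 10 * v j + v (j + 1) =
      step_rhs \<alpha>\<^sub>1 \<alpha>\<^sub>2 K\<^sub>1 K\<^sub>2 M h \<tau> f u N j"
    using tridiagonal_solvable[OF two assms(3)] by blast
  \<comment> \<open>Only the new level is replaced, so the equations up to level \<open>N\<close>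
    and the data of the new system are preserved.\<close>
  define w where "w = (\<lambda>(j, k). if k = Suc N then v j else u (j, k))"
  have "scheme_S1 \<alpha>\<^sub>1 \<alpha>\<^sub>2 K\<^sub>1 K\<^sub>2 M N h \<tau> f \<phi>\<^sub>1 \<phi>\<^sub>2 w"
    using u scheme_S1_cong[OF assms(1,2), of M N w u] by (simp add: w_def)
  moreover have "step_rhs \<alpha>\<^sub>1 \<alpha>\<^sub>2 K\<^sub>1 K\<^sub>2 M h \<tau> f w N j = step_rhs \<alpha>\<^sub>1 \<alpha>\<^sub>2 K\<^sub>1 K\<^sub>2 M h \<tau> f u N j"
    if "j < M" for j
    using that by (intro step_rhs_cong) (auto simp: w_def)
  moreover have "w (j, Suc N) = v j" for j
    by (simp add: w_def)
  ultimately have "scheme_S1 \<alpha>\<^sub>1 \<alpha>\<^sub>2 K\<^sub>1 K\<^sub>2 M (Suc N) h \<tau> f \<phi>\<^sub>1 \<phi>\<^sub>2 w"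
    using v by (simp add: scheme_S1_Suc[OF assms(1,2)])
  thus ?case by blast
qed

lemma scheme_S1_unique:
  assumes "h \<noteq> 0" "\<tau> \<noteq> 0" "0 < M"
    and "scheme_S1 \<alpha>\<^sub>1 \<alpha>\<^sub>2 K\<^sub>1 K\<^sub>2 M N h \<tau> f \<phi>\<^sub>1 \<phi>\<^sub>2 u" "scheme_S1 \<alpha>\<^sub>1 \<alpha>\<^sub>2 K\<^sub>1 K\<^sub>2 M N h \<tau> f \<phi>\<^sub>1 \<phi>\<^sub>2 w"
    and "j \<le> M" "k \<le> N"
  shows "u (j, k) = w (j, k)"
  using assms(4-)
proof (induction N arbitrary: j k)
  case 0
  thus ?case by (simp add: scheme_S1_iff[OF assms(1,2)])
next
  case (Suc N)
  note S = Suc.prems(1,2)[unfolded scheme_S1_Suc[OF assms(1,2)]]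
  have prev: "u (i, m) = w (i, m)" if "i \<le> M" "m \<le> N" for i m
    using Suc.IH S that by blast
  hence rhs: "step_rhs \<alpha>\<^sub>1 \<alpha>\<^sub>2 K\<^sub>1 K\<^sub>2 M h \<tau> f u N i =
      step_rhs \<alpha>\<^sub>1 \<alpha>\<^sub>2 K\<^sub>1 K\<^sub>2 M h \<tau> f w N i" if "i < M" for i
    using that by (intro step_rhs_cong) auto
  have last: "u (j, Suc N) = w (j, Suc N)"
  proof (rule tridiagonal_unique[of 10 M "\<lambda>i. u (i, Suc N)" "\<lambda>i. w (i, Suc N)"
        "step_rhs \<alpha>\<^sub>1 \<alpha>\<^sub>2 K\<^sub>1 K\<^sub>2 M h \<tau> f u N"])
    show "2 \<le> \<bar>10 :: real\<bar>" by simp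
    show "u (0, Suc N) = w (0, Suc N)" "u (M, Suc N) = w (M, Suc N)"
      using S by (simp_all del: of_nat_Suc)
    fix i assume i: "1 \<le> i" "i < M"
    show "u (i - 1, Suc N) + 10 * u (i, Suc N) + u (i + 1, Suc N) =
        step_rhs \<alpha>\<^sub>1 \<alpha>\<^sub>2 K\<^sub>1 K\<^sub>2 M h \<tau> f u N i"
      using S(1) i by blast
    \<comment> \<open>Agreement on the earlier levels lets the system for \<open>w\<close> be
      written with the data of \<open>u\<close>, so both new levels solve the same Dirichlet
      problem.\<close>
    show "w (i - 1, Suc N) + 10 * w (i, Suc N) + w (i + 1, Suc N) =
        step_rhs \<alpha>\<^sub>1 \<alpha>\<^sub>2 K\<^sub>1 K\<^sub>2 M h \<tau> f u N i"
      unfolding rhs[OF i(2)] using S(2) i by blast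
  qed (use assms(3) Suc.prems(3) in simp_all)
  show ?case
  proof (cases "k = Suc N")
    case False
    thus ?thesis using prev Suc.prems(3,4) by simp
  qed (simp add: last)
qed

text \<open>A grid function is encoded as a total function that is \<open>undefined\<close> off the
  grid; this normalization turns uniqueness of the grid values into equality of functions.\<close>

theorem theorem3p1:
  fixes \<alpha>\<^sub>1 \<alpha>\<^sub>2 K\<^sub>1 K\<^sub>2 L T h \<tau> :: real and M N :: nat
    and f :: "real \<Rightarrow> real \<Rightarrow> real" and \<phi>\<^sub>1 \<phi>\<^sub>2 :: "real \<Rightarrow> real"
  assumes "0 < \<alpha>\<^sub>1" "\<alpha>\<^sub>1 < 1" "0 < \<alpha>\<^sub>2" "\<alpha>\<^sub>2 < 1"
    and "0 < L" "0 < T" "0 < M" "0 < N"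
    and "h = L / real M" "\<tau> = T / real N"
  shows "\<exists>!u. u \<in> extensional ({0..M} \<times> {0..N}) \<and>
    scheme_S1 \<alpha>\<^sub>1 \<alpha>\<^sub>2 K\<^sub>1 K\<^sub>2 M N h \<tau> f \<phi>\<^sub>1 \<phi>\<^sub>2 u"
proof -
  have nz: "h \<noteq> 0" "\<tau> \<noteq> 0" using assms by simp_all
  obtain u where u: "scheme_S1 \<alpha>\<^sub>1 \<alpha>\<^sub>2 K\<^sub>1 K\<^sub>2 M N h \<tau> f \<phi>\<^sub>1 \<phi>\<^sub>2 u"
    using scheme_S1_exists[OF nz \<open>0 < M\<close>] by blast
  show ?thesis
  proof (rule ex_ex1I)
    \<comment> \<open>Restriction resets only values off the grid, which the scheme does not
      see.\<close>
    have "scheme_S1 \<alpha>\<^sub>1 \<alpha>\<^sub>2 K\<^sub>1 K\<^sub>2 M N h \<tau> f \<phi>\<^sub>1 \<phi>\<^sub>2 (restrict u ({0..M} \<times> {0..N}))"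
      using u scheme_S1_cong[OF nz, of M N "restrict u ({0..M} \<times> {0..N})" u] by simp
    thus "\<exists>u. u \<in> extensional ({0..M} \<times> {0..N}) \<and>
        scheme_S1 \<alpha>\<^sub>1 \<alpha>\<^sub>2 K\<^sub>1 K\<^sub>2 M N h \<tau> f \<phi>\<^sub>1 \<phi>\<^sub>2 u"
      using restrict_extensional by blast
  next
    fix v w
    assume v: "v \<in> extensional ({0..M} \<times> {0..N}) \<and> scheme_S1 \<alpha>\<^sub>1 \<alpha>\<^sub>2 K\<^sub>1 K\<^sub>2 M N h \<tau> f \<phi>\<^sub>1 \<phi>\<^sub>2 v"
      and w: "w \<in> extensional ({0..M} \<times> {0..N}) \<and> scheme_S1 \<alpha>\<^sub>1 \<alpha>\<^sub>2 K\<^sub>1 K\<^sub>2 M N h \<tau> f \<phi>\<^sub>1 \<phi>\<^sub>2 w"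
    show "v = w"
    proof (rule extensionalityI[of _ "{0..M} \<times> {0..N}"])
      show "v p = w p" if "p \<in> {0..M} \<times> {0..N}" for p
        using that v w scheme_S1_unique[OF nz \<open>0 < M\<close>] by auto
    qed (use v w in auto)
  qed
qed

end
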